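(* Let $G$ be a graph with degree sequence $\pi$. The following are equivalent. (1) $G$ belongs to $HU$. (2) $G$ contains no element of $\mathcal{F}$ as an induced subgraph. (3) The sequence $\pi$ does not Rao-contain any element of $\mathcal{L}_1$, where $$\mathcal{L}_1=\{(2,2,2,1,1),\ (3,2,2,2,1),\ (3,3,2,2,2),\ (2,2,1,1,1,1),\ (4,3,3,2,1,1),\ (4,4,3,2,2,1),\ (4,4,4,4,3,3)\}.$$
   Context: All graphs are finite and simple. The degree sequence of a graph is the list of its vertex degrees in non-increasing order, and a realization of a sequence is a graph having it as degree sequence. A \emph{unigraph} is a graph that is isomorphic to every graph with the same degree sequence. $HU$ (hereditary unigraphs) is the largest class of unigraphs closed under taking induced subgraphs, i.e. the class of unigraphs all of whose induced subgraphs are unigraphs. For degree sequences $\pi,\rho$ of graphs, $\rho$ \emph{Rao-contains} $\pi$, written $\pi\preceq\rho$, if there exist a realization $G$ of $\pi$ and a realization $H$ of $\rho$ such that $G$ is an induced subgraph of $H$. $\mathcal{F}$ is the following set of 16 graphs (up to isomorphism): the graph $K_2+C_4$ (disjoint union), its complement, and all realizations of the seven degree sequences in $\mathcal{L}_1$ (each of these sequences has exactly two realizations up to isomorphism). *)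

theory Defs
  imports "Graph_Theory.Graph_Theory" "HOL-Library.Multiset"
begin

text \<open>
  A finite simple graph is a \<^locale>\<open>pair_graph\<close>: a finite, loop-free, symmetric digraph whose
  arcs are pairs of vertices.  The null graph is allowed.  An undirected edge is a pair of
  opposite arcs, so the degree of a vertex is its out-degree.
\<close>

definition degree_seq :: "'a pair_pre_digraph \<Rightarrow> nat list" where
  "degree_seq G = rev (sorted_list_of_multiset
     (image_mset (out_degree (with_proj G)) (mset_set (pverts G))))"

text \<open>
  Quantification over all graphs is rendered as quantification over graphs with vertices of
  type \<^typ>\<open>nat\<close>; every finite graph is isomorphic to one of these.
\<close>

definition realization :: "'a pair_pre_digraph \<Rightarrow> nat list \<Rightarrow> bool" where
  "realization G \<pi> \<longleftrightarrow> pair_graph G \<and> degree_seq G = \<pi>"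

definition unigraph :: "'a pair_pre_digraph \<Rightarrow> bool" where
  "unigraph G \<longleftrightarrow> pair_graph G \<and>
     (\<forall>H :: nat pair_pre_digraph. realization H (degree_seq G) \<longrightarrow>
        digraph_iso (with_proj G) (with_proj H))"

definition hereditary_unigraph :: "'a pair_pre_digraph \<Rightarrow> bool" where
  "hereditary_unigraph G \<longleftrightarrow> unigraph G \<and>
     (\<forall>H :: 'a pair_pre_digraph. induced_subgraph (with_proj H) (with_proj G) \<longrightarrow> unigraph H)"

definition contains_induced :: "'a pair_pre_digraph \<Rightarrow> 'b pair_pre_digraph \<Rightarrow> bool" where
  "contains_induced G F \<longleftrightarrow>
     (\<exists>H :: 'a pair_pre_digraph. induced_subgraph (with_proj H) (with_proj G) \<and>
        digraph_iso (with_proj F) (with_proj H))"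

definition rao_contained :: "nat list \<Rightarrow> nat list \<Rightarrow> bool" (infix \<open>\<preceq>\<close> 50) where
  "\<pi> \<preceq> \<rho> \<longleftrightarrow> (\<exists>(G :: nat pair_pre_digraph) (H :: nat pair_pre_digraph).
     realization G \<pi> \<and> realization H \<rho> \<and> induced_subgraph (with_proj G) (with_proj H))"

definition graph_complement :: "'a pair_pre_digraph \<Rightarrow> 'a pair_pre_digraph" where
  "graph_complement G = \<lparr> pverts = pverts G,
     parcs = {(u, v). u \<in> pverts G \<and> v \<in> pverts G \<and> u \<noteq> v \<and> (u, v) \<notin> parcs G} \<rparr>"

text \<open>The edge on 0, 1 together with the four-cycle 2, 3, 4, 5.\<close>

definition K2_plus_C4 :: "nat pair_pre_digraph" where
  "K2_plus_C4 = \<lparr> pverts = {0..<6},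
     parcs = (let E = {(0, 1), (2, 3), (3, 4), (4, 5), (5, 2)} in E \<union> E\<inverse>) \<rparr>"

definition L1 :: "nat list set" where
  "L1 = {[2,2,2,1,1], [3,2,2,2,1], [3,3,2,2,2], [2,2,1,1,1,1],
         [4,3,3,2,1,1], [4,4,3,2,2,1], [4,4,4,4,3,3]}"

text \<open>
  The set is closed under isomorphism: it consists of all copies, on vertices of type
  \<^typ>\<open>nat\<close>, of the sixteen forbidden graphs.
\<close>

definition forbidden_graphs :: "nat pair_pre_digraph set" where
  "forbidden_graphs =
     {F. digraph_iso (with_proj K2_plus_C4) (with_proj F)} \<union>
     {F. digraph_iso (with_proj (graph_complement K2_plus_C4)) (with_proj F)} \<union>
     {F. \<exists>\<pi>\<in>L1. realization F \<pi>}"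

end

theory Submission
  imports Defs "HOL-Combinatorics.Transposition"
begin

text \<open>
  Everything rests on switches.  If \<open>ab\<close> and \<open>cd\<close> are edges and \<open>ad\<close> and \<open>bc\<close> are non-edges, then
  exchanging these edges for these non-edges preserves all degrees, and any two graphs on the same
  vertices with the same degree at each vertex are linked by such switches (\<open>switch_connected\<close>).
  Hence a graph is a unigraph as soon as no chain of switches can leave its isomorphism class.

  The heart of the proof is the local lemma \<open>forbidden_free_twins\<close>: for every switch in a graph
  without forbidden induced subgraphs, either \<open>a\<close> and \<open>c\<close>, or \<open>b\<close> and \<open>d\<close>, are adjacent to the same
  vertices outside \<open>{a, b, c, d}\<close>.  Otherwise a vertex \<open>v\<close> distinguishes \<open>a\<close> from \<open>c\<close> and a vertex
  \<open>w\<close> distinguishes \<open>b\<close> from \<open>d\<close>, and the at most six vertices involved induce a forbidden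
  subgraph.  If \<open>a\<close> and \<open>c\<close> agree outside, then transposing them maps the graph onto the switched
  graph, and likewise for \<open>b\<close> and \<open>d\<close>.  So switching stays in the isomorphism class; as freeness
  from forbidden subgraphs is an invariant of that class and passes to induced subgraphs,
  forbidden-free graphs are hereditary unigraphs
  (\<open>forbidden_free_isomorphic_if_degree_seq_eq\<close>, \<open>forbidden_free_hereditary_unigraph\<close>).

  Conversely, each of the nine degree sequences of forbidden graphs has two non-isomorphic
  realizations (\<open>two_realizations\<close>), so no forbidden graph is a unigraph.

  For Rao containment, an induced subgraph of a graph \<open>G\<close> witnesses that the degree sequence of
  \<open>G\<close> contains that of the subgraph.  This deals with the forbidden graphs that realize a sequence
  in \<^term>\<open>L1\<close>.  An induced \<open>K\<^sub>2 + C\<^sub>4\<close> can be switched into a path on six vertices, which has an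
  induced path on five vertices, of degree sequence \<open>(2,2,2,1,1)\<close>; the complement of
  \<open>K\<^sub>2 + C\<^sub>4\<close> yields \<open>(3,3,2,2,2)\<close> in the same way.  In the other direction, if the degree sequence
  of a forbidden-free graph \<open>G\<close> contained a member of \<^term>\<open>L1\<close>, then some graph with the degree
  sequence of \<open>G\<close> would contain a forbidden graph; but that graph is isomorphic to \<open>G\<close>.
\<close>
section \<open>Pair graphs, induced subgraphs and isomorphism\<close>

abbreviation isomorphic :: "'a pair_pre_digraph \<Rightarrow> 'b pair_pre_digraph \<Rightarrow> bool" (infix "\<simeq>" 50) where
  "G \<simeq> H \<equiv> digraph_iso (with_proj G) (with_proj H)"

abbreviation deg :: "'a pair_pre_digraph \<Rightarrow> 'a \<Rightarrow> nat" where
  "deg G \<equiv> out_degree (with_proj G)"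

definition induce :: "'a pair_pre_digraph \<Rightarrow> 'a set \<Rightarrow> 'a pair_pre_digraph" where
  "induce G S = \<lparr>pverts = S, parcs = parcs G \<inter> S \<times> S\<rparr>"

lemma induce_simps [simp]:
  "pverts (induce G S) = S"
  "parcs (induce G S) = parcs G \<inter> S \<times> S"
  by (simp_all add: induce_def)

lemma pair_graph_iff:
  "pair_graph G \<longleftrightarrow> finite (pverts G) \<and> parcs G \<subseteq> pverts G \<times> pverts G \<and>
     (\<forall>u v. (u, v) \<in> parcs G \<longrightarrow> (v, u) \<in> parcs G) \<and> (\<forall>u. (u, u) \<notin> parcs G)"
  (is "?L \<longleftrightarrow> ?R")
proof
  assume ?L
  then interpret pair_graph G .
  show ?R
    using pair_finite_verts wellformed' arcs_symmetric no_loops' by fastforce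
next
  assume R: ?R
  have "wf_digraph (with_proj G)"
    using R by unfold_locales auto
  moreover have "finite (parcs G)"
    using R by (meson finite_SigmaI finite_subset)
  moreover have "symmetric (with_proj G)"
    using R by (auto simp: symmetric_def intro: symI)
  ultimately show ?L
    using R by unfold_locales auto
qed

lemma deg_card: "deg G v = card {u. (v, u) \<in> parcs G}"
proof -
  have "out_arcs (with_proj G) v = Pair v ` {u. (v, u) \<in> parcs G}"
    by (auto simp: out_arcs_def)
  then show ?thesis
    by (simp add: out_degree_def card_image inj_on_def)
qed

lemma pair_graph_induce:
  assumes "pair_graph G" "S \<subseteq> pverts G"
  shows "pair_graph (induce G S)"
  using assms finite_subset by (auto simp: pair_graph_iff)

lemma induce_induce: "T \<subseteq> S \<Longrightarrow> induce (induce G S) T = induce G T"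
  by (auto simp: induce_def)

lemma induced_subgraph_iff:
  assumes "pair_graph G"
  shows "induced_subgraph (with_proj H) (with_proj G) \<longleftrightarrow>
         pverts H \<subseteq> pverts G \<and> H = induce G (pverts H)"
    (is "?L \<longleftrightarrow> ?R")
proof
  assume ?L
  then have "pverts H \<subseteq> pverts G" "parcs H = parcs G \<inter> pverts H \<times> pverts H"
    by (auto simp: induced_subgraph_def subgraph_def)
  then show ?R
    by (simp add: induce_def)
next
  assume R: ?R
  interpret G: pair_graph G by fact
  have "pair_graph H"
    using R pair_graph_induce[OF assms] by metis
  then interpret H: pair_graph H .
  have "parcs H = parcs G \<inter> pverts H \<times> pverts H"
    using R by (metis induce_simps(2))
  then show ?L
    using R H.wf_digraph_axioms G.wf_digraph_axioms
    by (auto simp: induced_subgraph_def subgraph_def compatible_def)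
qed

lemma contains_induced_iff:
  assumes "pair_graph G"
  shows "contains_induced G F \<longleftrightarrow> (\<exists>S\<subseteq>pverts G. F \<simeq> induce G S)"
proof
  assume "contains_induced G F"
  then obtain H where "induced_subgraph (with_proj H) (with_proj G)" "F \<simeq> H"
    by (auto simp: contains_induced_def)
  then show "\<exists>S\<subseteq>pverts G. F \<simeq> induce G S"
    using induced_subgraph_iff[OF assms] by metis
next
  assume "\<exists>S\<subseteq>pverts G. F \<simeq> induce G S"
  then show "contains_induced G F"
    using induced_subgraph_iff[OF assms] by (metis contains_induced_def induce_simps(1))
qed

lemma isomorphicI:
  assumes "pair_graph G" "pair_graph H" and f: "bij_betw f (pverts G) (pverts H)"
    and adj: "\<And>u v. u \<in> pverts G \<Longrightarrow> v \<in> pverts G \<Longrightarrow>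
                (u, v) \<in> parcs G \<longleftrightarrow> (f u, f v) \<in> parcs H"
  shows "G \<simeq> H"
proof -
  interpret G: pair_graph G by fact
  let ?h = "\<lparr>iso_verts = f, iso_arcs = map_prod f f, iso_head = snd, iso_tail = fst\<rparr>"
  have sub: "parcs G \<subseteq> pverts G \<times> pverts G" "parcs H \<subseteq> pverts H \<times> pverts H"
    using assms(1,2) by (simp_all add: pair_graph_iff)
  have "inj_on f (pverts G)"
    using f by (simp add: bij_betw_def)
  then have "inj_on (map_prod f f) (pverts G \<times> pverts G)"
    using map_prod_inj_on by blast
  then have "inj_on (map_prod f f) (parcs G)"
    using sub(1) inj_on_subset by blast
  then have hom: "pre_digraph.digraph_isomorphism (with_proj G) ?h"
    using \<open>inj_on f _\<close> G.wf_digraph_axioms by (auto simp: pre_digraph.digraph_isomorphism_def)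
  have "map_prod f f ` parcs G = parcs H"
  proof
    show "map_prod f f ` parcs G \<subseteq> parcs H"
      using sub(1) adj by auto
    show "parcs H \<subseteq> map_prod f f ` parcs G"
    proof
      fix e assume e: "e \<in> parcs H"
      then obtain x y where xy: "e = (x, y)" "x \<in> pverts H" "y \<in> pverts H"
        using sub(2) by auto
      then obtain u v where "u \<in> pverts G" "v \<in> pverts G" "x = f u" "y = f v"
        using f by (metis bij_betw_imp_surj_on imageE)
      then show "e \<in> map_prod f f ` parcs G"
        using adj e xy(1) by (metis image_eqI map_prod_simp)
    qed
  qed
  then have "with_proj H = app_iso ?h (with_proj G)"
    using f by (simp add: with_proj_def app_iso_def bij_betw_def)
  then show ?thesis
    using hom by (auto simp: digraph_iso_def)
qed

lemma isomorphicE: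
  assumes "G \<simeq> H" "pair_graph G"
  obtains f where "bij_betw f (pverts G) (pverts H)"
    "\<And>u v. u \<in> pverts G \<Longrightarrow> v \<in> pverts G \<Longrightarrow> (u, v) \<in> parcs G \<longleftrightarrow> (f u, f v) \<in> parcs H"
    "parcs H \<subseteq> pverts H \<times> pverts H"
proof -
  obtain h where hom: "pre_digraph.digraph_isomorphism (with_proj G) h"
    and H: "with_proj H = app_iso h (with_proj G)"
    using assms(1) by (auto simp: digraph_iso_def)
  let ?f = "iso_verts h"
  have inj: "inj_on ?f (pverts G)" and arcs: "\<And>e. e \<in> parcs G \<Longrightarrow>
      ?f (fst e) = iso_tail h (iso_arcs h e) \<and> ?f (snd e) = iso_head h (iso_arcs h e)"
    using hom by (auto simp: pre_digraph.digraph_isomorphism_def)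
  have HV: "pverts H = ?f ` pverts G" and HA: "parcs H = iso_arcs h ` parcs G"
    and "iso_tail h = fst" "iso_head h = snd"
    using H by (simp_all add: with_proj_def app_iso_def)
  then have "\<And>e. e \<in> parcs G \<Longrightarrow> iso_arcs h e = map_prod ?f ?f e"
    using arcs by (auto simp: prod_eq_iff)
  then have A: "parcs H = map_prod ?f ?f ` parcs G"
    using HA by auto
  have sub: "parcs G \<subseteq> pverts G \<times> pverts G"
    using assms(2) by (simp add: pair_graph_iff)
  show thesis
  proof
    show "bij_betw ?f (pverts G) (pverts H)"
      using inj HV by (simp add: bij_betw_def)
    show "(u, v) \<in> parcs G \<longleftrightarrow> (?f u, ?f v) \<in> parcs H"
      if "u \<in> pverts G" "v \<in> pverts G" for u v
    proof
      assume "(?f u, ?f v) \<in> parcs H"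
      then obtain x y where "(x, y) \<in> parcs G" "?f x = ?f u" "?f y = ?f v"
        using A by auto
      moreover from this have "x = u" "y = v"
        using inj that sub by (auto dest: inj_onD)
      ultimately show "(u, v) \<in> parcs G"
        by simp
    qed (use A in force)
    show "parcs H \<subseteq> pverts H \<times> pverts H"
      using A HV sub by auto
  qed
qed

lemma isomorphic_pair_graph:
  assumes "G \<simeq> H" "pair_graph G"
  shows "pair_graph H"
proof -
  obtain f where f: "bij_betw f (pverts G) (pverts H)"
    "\<And>u v. u \<in> pverts G \<Longrightarrow> v \<in> pverts G \<Longrightarrow> (u, v) \<in> parcs G \<longleftrightarrow> (f u, f v) \<in> parcs H"
    "parcs H \<subseteq> pverts H \<times> pverts H"
    using isomorphicE[OF assms] by blast
  have G: "finite (pverts G)" "\<And>u v. (u, v) \<in> parcs G \<Longrightarrow> (v, u) \<in> parcs G"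
    "\<And>u. (u, u) \<notin> parcs G"
    using assms(2) by (auto simp: pair_graph_iff)
  have surj: "\<exists>u\<in>pverts G. x = f u" if "x \<in> pverts H" for x
    using f(1) that by (metis bij_betw_imp_surj_on imageE)
  have "finite (pverts H)"
    using f(1) G(1) bij_betw_finite by blast
  moreover have "(y, x) \<in> parcs H" if xy: "(x, y) \<in> parcs H" for x y
  proof -
    obtain u v where "u \<in> pverts G" "v \<in> pverts G" "x = f u" "y = f v"
      using xy f(3) surj by blast
    then show ?thesis
      using xy f(2) G(2) by blast
  qed
  moreover have "(x, x) \<notin> parcs H" for x
  proof
    assume xx: "(x, x) \<in> parcs H"
    then obtain u where "u \<in> pverts G" "x = f u"
      using f(3) surj by blast
    then show False
      using xx f(2) G(3) by blast
  qed
  ultimately show ?thesis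
    using f(3) by (auto simp: pair_graph_iff)
qed

lemma isomorphic_refl: "pair_graph G \<Longrightarrow> G \<simeq> G"
  by (rule isomorphicI[of G G id]) auto

lemma isomorphic_sym:
  assumes "G \<simeq> H" "pair_graph G"
  shows "H \<simeq> G"
proof -
  interpret G: pair_graph G by fact
  show ?thesis
    using digraph_iso_swap[OF G.wf_digraph_axioms assms(1)] .
qed

definition map_graph :: "('a \<Rightarrow> 'b) \<Rightarrow> 'a pair_pre_digraph \<Rightarrow> 'b pair_pre_digraph" where
  "map_graph f G = \<lparr>pverts = f ` pverts G, parcs = map_prod f f ` parcs G\<rparr>"

lemma map_graph_adjacent_iff:
  assumes "pair_graph G" "inj_on f (pverts G)" "u \<in> pverts G" "v \<in> pverts G"
  shows "(f u, f v) \<in> parcs (map_graph f G) \<longleftrightarrow> (u, v) \<in> parcs G"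
proof
  assume "(f u, f v) \<in> parcs (map_graph f G)"
  then obtain x y where "(x, y) \<in> parcs G" "f x = f u" "f y = f v"
    by (auto simp: map_graph_def)
  moreover from this have "x = u" "y = v"
    using assms by (auto simp: pair_graph_iff dest: inj_onD)
  ultimately show "(u, v) \<in> parcs G"
    by simp
qed (force simp: map_graph_def)

lemma pair_graph_map_graph:
  assumes "pair_graph G" "inj_on f (pverts G)"
  shows "pair_graph (map_graph f G)"
  unfolding pair_graph_iff
proof (intro conjI allI impI)
  have G: "parcs G \<subseteq> pverts G \<times> pverts G"
    "\<And>u v. (u, v) \<in> parcs G \<Longrightarrow> (v, u) \<in> parcs G" "\<And>u. (u, u) \<notin> parcs G"
    using assms(1) by (auto simp: pair_graph_iff)
  show "finite (pverts (map_graph f G))"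
    using assms(1) by (simp add: map_graph_def pair_graph_iff)
  show "parcs (map_graph f G) \<subseteq> pverts (map_graph f G) \<times> pverts (map_graph f G)"
    using G(1) by (auto simp: map_graph_def)
  show "(y, x) \<in> parcs (map_graph f G)" if "(x, y) \<in> parcs (map_graph f G)" for x y
    using that G(2) by (force simp: map_graph_def)
  show "(x, x) \<notin> parcs (map_graph f G)" for x
  proof
    assume xx: "(x, x) \<in> parcs (map_graph f G)"
    then obtain u where "u \<in> pverts G" "x = f u"
      using G(1) by (auto simp: map_graph_def)
    then show False
      using xx map_graph_adjacent_iff[OF assms] G(3) by blast
  qed
qed

lemma isomorphic_map_graph:
  assumes "pair_graph G" "inj_on f (pverts G)"
  shows "G \<simeq> map_graph f G"
  using map_graph_adjacent_iff[OF assms] assms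
  by (intro isomorphicI[OF assms(1) pair_graph_map_graph[OF assms], of f])
     (auto simp: bij_betw_def map_graph_def)

text \<open>
  Forbidden graphs and Rao containment speak of vertices of type \<^typ>\<open>nat\<close>, the given graph of an
  arbitrary vertex type; this lemma moves from the latter to the former.
\<close>
lemma isomorphic_nat_copy:
  assumes "pair_graph (G :: 'a pair_pre_digraph)"
  obtains H :: "nat pair_pre_digraph" where "G \<simeq> H"
proof -
  obtain f :: "'a \<Rightarrow> nat" where "inj_on f (pverts G)"
    using assms finite_imp_inj_to_nat_seg[of "pverts G"] by (auto simp: pair_graph_iff)
  then show thesis
    using that isomorphic_map_graph[OF assms] by blast
qed

lemma isomorphic_induce:
  assumes "G \<simeq> H" "pair_graph G" "S \<subseteq> pverts G"
  obtains T where "T \<subseteq> pverts H" "induce G S \<simeq> induce H T"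
proof -
  obtain f where f: "bij_betw f (pverts G) (pverts H)"
    "\<And>u v. u \<in> pverts G \<Longrightarrow> v \<in> pverts G \<Longrightarrow> (u, v) \<in> parcs G \<longleftrightarrow> (f u, f v) \<in> parcs H"
    "parcs H \<subseteq> pverts H \<times> pverts H"
    using isomorphicE[OF assms(1,2)] by blast
  have T: "f ` S \<subseteq> pverts H"
    using f(1) assms(3) by (auto simp: bij_betw_def)
  have "pair_graph (induce G S)" "pair_graph (induce H (f ` S))"
    using pair_graph_induce assms isomorphic_pair_graph T by blast+
  moreover have "bij_betw f S (f ` S)"
    using f(1) assms(3) by (meson bij_betw_subset)
  ultimately have "induce G S \<simeq> induce H (f ` S)"
    using f(2) assms(3) by (intro isomorphicI[of _ _ f]) auto
  then show thesis
    using that T by blast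
qed

lemma isomorphic_deg:
  assumes "pair_graph G" "pair_graph H" and f: "bij_betw f (pverts G) (pverts H)"
    and adj: "\<And>u v. u \<in> pverts G \<Longrightarrow> v \<in> pverts G \<Longrightarrow>
                (u, v) \<in> parcs G \<longleftrightarrow> (f u, f v) \<in> parcs H"
    and v: "v \<in> pverts G"
  shows "deg H (f v) = deg G v"
proof -
  have "{y. (f v, y) \<in> parcs H} = f ` {u. (v, u) \<in> parcs G}" (is "?A = ?B")
  proof
    show "?B \<subseteq> ?A"
      using adj v assms(1) by (auto simp: pair_graph_iff)
    show "?A \<subseteq> ?B"
    proof
      fix y assume y: "y \<in> ?A"
      then have "y \<in> pverts H"
        using assms(2) by (auto simp: pair_graph_iff)
      then obtain u where "u \<in> pverts G" "y = f u"
        using f by (metis bij_betw_imp_surj_on imageE)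
      then show "y \<in> ?B"
        using y adj v by auto
    qed
  qed
  moreover have "inj_on f {u. (v, u) \<in> parcs G}"
    using f assms(1) by (auto simp: bij_betw_def pair_graph_iff intro: inj_on_subset)
  ultimately show ?thesis
    by (simp add: deg_card card_image)
qed

section \<open>Degree sequences\<close>

lemma degree_seq_eq_iff:
  "degree_seq G = degree_seq H \<longleftrightarrow>
   image_mset (deg G) (mset_set (pverts G)) = image_mset (deg H) (mset_set (pverts H))"
  unfolding degree_seq_def by (metis mset_sorted_list_of_multiset rev_rev_ident)

lemma degree_seq_isomorphic:
  assumes "G \<simeq> H" "pair_graph G"
  shows "degree_seq H = degree_seq G"
proof -
  obtain f where f: "bij_betw f (pverts G) (pverts H)"
    "\<And>u v. u \<in> pverts G \<Longrightarrow> v \<in> pverts G \<Longrightarrow> (u, v) \<in> parcs G \<longleftrightarrow> (f u, f v) \<in> parcs H"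
    "parcs H \<subseteq> pverts H \<times> pverts H"
    using isomorphicE[OF assms] by blast
  have fin: "finite (pverts G)"
    using assms(2) by (simp add: pair_graph_iff)
  have "image_mset (deg H) (mset_set (pverts H)) = image_mset (deg H) (image_mset f (mset_set (pverts G)))"
    using f(1) by (simp add: bij_betw_def image_mset_mset_set)
  also have "\<dots> = image_mset (deg G) (mset_set (pverts G))"
    using isomorphic_deg[OF assms(2) isomorphic_pair_graph[OF assms] f(1,2)] fin
    by (auto simp: multiset.map_comp intro!: image_mset_cong)
  finally show ?thesis
    by (simp add: degree_seq_eq_iff)
qed

lemma deg_list:
  assumes "distinct xs" "{u. (v, u) \<in> parcs G} \<subseteq> set xs"
  shows "deg G v = length (filter (\<lambda>u. (v, u) \<in> parcs G) xs)"
proof -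
  have "{u. (v, u) \<in> parcs G} = set (filter (\<lambda>u. (v, u) \<in> parcs G) xs)"
    using assms(2) by auto
  then show ?thesis
    using assms(1) by (metis deg_card distinct_card distinct_filter)
qed

text \<open>
  With the vertices listed, a degree sequence is obtained by counting along the list, so that
  rewriting can evaluate it once all adjacencies are known.
\<close>
lemma degree_seq_list:
  assumes "distinct xs" "pverts G = set xs" "parcs G \<subseteq> pverts G \<times> pverts G"
  shows "degree_seq G = rev (sort (map (\<lambda>v. length (filter (\<lambda>u. (v, u) \<in> parcs G) xs)) xs))"
proof -
  have "deg G = (\<lambda>v. length (filter (\<lambda>u. (v, u) \<in> parcs G) xs))"
    using assms by (intro ext deg_list) auto
  then have "image_mset (deg G) (mset_set (pverts G))
      = mset (map (\<lambda>v. length (filter (\<lambda>u. (v, u) \<in> parcs G) xs)) xs)"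
    using assms(1,2) by (simp add: mset_set_set)
  then show ?thesis
    unfolding degree_seq_def by (metis sorted_list_of_multiset_mset)
qed

lemma degree_seq_induce_list:
  assumes "distinct xs"
  shows "degree_seq (induce G (set xs)) =
         rev (sort (map (\<lambda>v. length (filter (\<lambda>u. (v, u) \<in> parcs G) xs)) xs))"
proof -
  have "map (\<lambda>v. length (filter (\<lambda>u. (v, u) \<in> parcs (induce G (set xs))) xs)) xs
      = map (\<lambda>v. length (filter (\<lambda>u. (v, u) \<in> parcs G) xs)) xs"
    by (auto intro!: arg_cong[where f = length] filter_cong)
  moreover have "degree_seq (induce G (set xs)) =
      rev (sort (map (\<lambda>v. length (filter (\<lambda>u. (v, u) \<in> parcs (induce G (set xs))) xs)) xs))"
    by (rule degree_seq_list[OF assms]) auto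
  ultimately show ?thesis
    by (simp only:)
qed

text \<open>
  For graphs with equal degree sequences this gives a degree-preserving bijection of the vertices,
  which reduces their comparison to graphs on one common vertex set.
\<close>
lemma bij_betw_of_image_mset_eq:
  assumes "finite A" "finite B" "image_mset f (mset_set A) = image_mset g (mset_set B)"
  shows "\<exists>h. bij_betw h A B \<and> (\<forall>x\<in>A. g (h x) = f x)"
  using assms
proof (induction A arbitrary: B rule: finite_induct)
  case empty
  then have "B = {}"
    by (metis image_mset_is_empty_iff mset_set.empty mset_set_empty_iff)
  then show ?case
    by (auto simp: bij_betw_def)
next
  case (insert a A)
  have "f a \<in># image_mset g (mset_set B)"
    using insert.hyps insert.prems(2) by (metis finite.insertI finite_set_mset_mset_set imageI
        insertI1 set_image_mset)
  then obtain b where b: "b \<in> B" "g b = f a"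
    using insert.prems(1) by auto
  have "mset_set B = add_mset b (mset_set (B - {b}))"
    using b(1) insert.prems(1) by (simp add: mset_set.remove)
  then have "image_mset f (mset_set A) = image_mset g (mset_set (B - {b}))"
    using insert.hyps insert.prems(2) b(2) by simp
  then obtain h where h: "bij_betw h A (B - {b})" "\<forall>x\<in>A. g (h x) = f x"
    using insert.IH insert.prems(1) by blast
  have "bij_betw (h(a := b)) A (B - {b})"
    using h(1) insert.hyps(2) by (metis bij_betw_cong fun_upd_other)
  then have "bij_betw (h(a := b)) (A \<union> {a}) ((B - {b}) \<union> {b})"
    using notIn_Un_bij_betw[of a A "h(a := b)" "B - {b}"] insert.hyps(2) by simp
  then have "bij_betw (h(a := b)) (insert a A) B"
    using b(1) by (simp add: insert_absorb)
  moreover have "\<forall>x\<in>insert a A. g ((h(a := b)) x) = f x"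
    using h(2) b(2) insert.hyps(2) by auto
  ultimately show ?case
    by blast
qed

section \<open>Switches\<close>

text \<open>
  The edges \<open>ab\<close>, \<open>cd\<close> and the non-edges \<open>bc\<close>, \<open>ad\<close> form an alternating four-cycle, while
  \<open>ac\<close> and \<open>bd\<close> are arbitrary.  The inequalities \<open>a \<noteq> d\<close> and \<open>b \<noteq> c\<close> keep degenerate pairs from
  counting as non-edges.
\<close>
definition switchable :: "'a pair_pre_digraph \<Rightarrow> 'a \<Rightarrow> 'a \<Rightarrow> 'a \<Rightarrow> 'a \<Rightarrow> bool" where
  "switchable G a b c d \<longleftrightarrow> (a, b) \<in> parcs G \<and> (c, d) \<in> parcs G \<and>
     (a, d) \<notin> parcs G \<and> (b, c) \<notin> parcs G \<and> a \<noteq> d \<and> b \<noteq> c"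

definition switch :: "'a pair_pre_digraph \<Rightarrow> 'a \<Rightarrow> 'a \<Rightarrow> 'a \<Rightarrow> 'a \<Rightarrow> 'a pair_pre_digraph" where
  "switch G a b c d = \<lparr>pverts = pverts G,
     parcs = parcs G - {(a, b), (b, a), (c, d), (d, c)} \<union> {(a, d), (d, a), (b, c), (c, b)}\<rparr>"

lemma pverts_switch [simp]: "pverts (switch G a b c d) = pverts G"
  by (simp add: switch_def)

lemma switchable_distinct:
  assumes "pair_graph G" "switchable G a b c d"
  shows "distinct [a, b, c, d]" "{a, b, c, d} \<subseteq> pverts G"
  using assms by (auto simp: pair_graph_iff switchable_def)

lemma pair_graph_switch:
  assumes "pair_graph G" "switchable G a b c d"
  shows "pair_graph (switch G a b c d)"
  using assms switchable_distinct[OF assms] by (auto simp: pair_graph_iff switch_def)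

lemma switch_reverse:
  assumes "pair_graph G" "switchable G a b c d"
  shows "switchable (switch G a b c d) a d c b" "switch (switch G a b c d) a d c b = G"
proof -
  have "\<And>u v. (u, v) \<in> parcs G \<Longrightarrow> (v, u) \<in> parcs G"
    using assms(1) by (simp add: pair_graph_iff)
  then show "switchable (switch G a b c d) a d c b" "switch (switch G a b c d) a d c b = G"
    using assms(2) switchable_distinct(1)[OF assms]
    by (auto simp: switchable_def switch_def intro!: pair_pre_digraph.equality)
qed

lemma deg_switch:
  assumes "pair_graph G" "switchable G a b c d"
  shows "deg (switch G a b c d) v = deg G v"
proof -
  let ?N = "\<lambda>v. {u. (v, u) \<in> parcs G}" and ?M = "\<lambda>v. {u. (v, u) \<in> parcs (switch G a b c d)}"
  note D = switchable_distinct(1)[OF assms]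
  have sym: "\<And>u v. (u, v) \<in> parcs G \<Longrightarrow> (v, u) \<in> parcs G"
    and "?N v \<subseteq> pverts G"
    using assms(1) by (auto simp: pair_graph_iff)
  then have fin: "finite (?N v)"
    using assms(1) finite_subset by (auto simp: pair_graph_iff)
  \<comment> \<open>A switch replaces at most one neighbour of each vertex by a non-neighbour.\<close>
  have exchange: "card (insert y (?N v - {x})) = card (?N v)" if "x \<in> ?N v" "y \<notin> ?N v" for x y
    using that fin card_Suc_Diff1[OF fin that(1)] by (simp add: card_insert_if del: card_Diff_insert)
  have "(\<exists>x y. x \<in> ?N v \<and> y \<notin> ?N v \<and> ?M v = insert y (?N v - {x})) \<or> ?M v = ?N v"
  proof -
    consider "v = a" | "v = b" | "v = c" | "v = d" | "v \<notin> {a, b, c, d}"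
      by blast
    then show ?thesis
    proof cases
      case 1
      then have "b \<in> ?N v \<and> d \<notin> ?N v \<and> ?M v = insert d (?N v - {b})"
        using D assms(2) by (auto simp: switch_def switchable_def)
      then show ?thesis by blast
    next
      case 2
      then have "a \<in> ?N v \<and> c \<notin> ?N v \<and> ?M v = insert c (?N v - {a})"
        using D assms(2) sym by (auto simp: switch_def switchable_def)
      then show ?thesis by blast
    next
      case 3
      then have "d \<in> ?N v \<and> b \<notin> ?N v \<and> ?M v = insert b (?N v - {d})"
        using D assms(2) sym by (auto simp: switch_def switchable_def)
      then show ?thesis by blast
    next
      case 4
      then have "c \<in> ?N v \<and> a \<notin> ?N v \<and> ?M v = insert a (?N v - {c})"
        using D assms(2) sym by (auto simp: switch_def switchable_def)
      then show ?thesis by blast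
    next
      case 5
      then have "?M v = ?N v"
        by (auto simp: switch_def)
      then show ?thesis by blast
    qed
  qed
  then show ?thesis
    using exchange by (metis deg_card)
qed

lemma degree_seq_switch:
  assumes "pair_graph G" "switchable G a b c d"
  shows "degree_seq (switch G a b c d) = degree_seq G"
  unfolding degree_seq_eq_iff using deg_switch[OF assms] by (metis pverts_switch ext)

definition switch_rel :: "'a pair_pre_digraph rel" where
  "switch_rel = {(G, switch G a b c d) | G a b c d. pair_graph G \<and> switchable G a b c d}"

lemma switch_relI:
  "pair_graph G \<Longrightarrow> switchable G a b c d \<Longrightarrow> (G, switch G a b c d) \<in> switch_rel"
  by (auto simp: switch_rel_def)

lemma sym_switch_rel: "sym switch_rel"
proof (rule symI)
  fix G H :: "'a pair_pre_digraph"
  assume "(G, H) \<in> switch_rel"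
  then obtain a b c d where "pair_graph G" "switchable G a b c d" "H = switch G a b c d"
    by (auto simp: switch_rel_def)
  then show "(H, G) \<in> switch_rel"
    using switch_relI[of H a d c b] switch_reverse[of G a b c d] pair_graph_switch[of G a b c d]
    by simp
qed

lemma switch_rtrancl_invariants:
  assumes "(G, H) \<in> switch_rel\<^sup>*" "pair_graph G"
  shows "pair_graph H" "pverts H = pverts G" "deg H v = deg G v"
proof -
  have "pair_graph H \<and> pverts H = pverts G \<and> deg H v = deg G v"
    using assms(1)
  proof (induction rule: rtrancl_induct)
    case base
    then show ?case
      using assms(2) by simp
  next
    case (step K H)
    then obtain a b c d where "H = switch K a b c d" "switchable K a b c d"
      unfolding switch_rel_def by blast
    then show ?case
      using step.IH by (simp add: pair_graph_switch deg_switch)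
  qed
  then show "pair_graph H" "pverts H = pverts G" "deg H v = deg G v"
    by simp_all
qed

text \<open>
  To exchange the neighbour \<open>z\<close> of \<open>v\<close> for the non-neighbour \<open>y\<close>, a vertex \<open>u\<close> is needed that is
  adjacent to \<open>y\<close> but not to \<open>z\<close>.  If \<open>y\<close> has at least as many neighbours as \<open>z\<close>, then \<open>u\<close> exists by
  counting, because \<open>v\<close> is a neighbour of \<open>z\<close> only.  Counting outside a set \<open>P\<close> yields \<open>u\<close> outside
  \<open>P\<close>, so that the switch leaves all edges at \<open>P\<close> alone.
\<close>
lemma exists_switch_to:
  assumes "pair_graph H"
    and vz: "(v, z) \<in> parcs H" and vy: "(v, y) \<notin> parcs H" and "y \<noteq> v"
    and P: "v \<notin> P" "y \<notin> P" "z \<notin> P"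
    and le: "card ({u. (z, u) \<in> parcs H} - P) \<le> card ({u. (y, u) \<in> parcs H} - P)"
  shows "\<exists>u. u \<notin> P \<and> switchable H v z u y"
proof -
  let ?Z = "{u. (z, u) \<in> parcs H} - P" and ?Y = "{u. (y, u) \<in> parcs H} - P"
  have H: "\<And>u v. (u, v) \<in> parcs H \<Longrightarrow> (v, u) \<in> parcs H" "\<And>u. (u, u) \<notin> parcs H"
    using assms(1) by (auto simp: pair_graph_iff)
  have fin: "finite ?Z" "finite ?Y"
    using assms(1) by (auto simp: pair_graph_iff intro: finite_subset[of _ "pverts H"])
  \<comment> \<open>A possible edge \<open>yz\<close> must not provide \<open>u = z\<close>; it contributes equally to both sides.\<close>
  have "y \<in> ?Z \<longleftrightarrow> z \<in> ?Y"
    using P H(1) by blast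
  then have "card (?Z - {y}) \<le> card (?Y - {z})"
    using fin le by (cases "y \<in> ?Z") (simp_all add: card_Diff_singleton_if)
  moreover have "v \<in> ?Z - {y}" "v \<notin> ?Y - {z}"
    using vz vy P H(1) \<open>y \<noteq> v\<close> by auto
  ultimately have "\<not> ?Y - {z} \<subseteq> ?Z - {y}"
    using fin by (metis card_seteq finite_Diff)
  then obtain u where "u \<in> ?Y" "u \<noteq> z" "u \<notin> ?Z - {y}"
    by blast
  then have "u \<notin> P" "(u, y) \<in> parcs H" "(z, u) \<notin> parcs H" "u \<noteq> z"
    using H by auto
  then show ?thesis
    using vz vy \<open>y \<noteq> v\<close> by (auto simp: switchable_def)
qed

definition agree_on :: "'a set \<Rightarrow> 'a pair_pre_digraph \<Rightarrow> 'a pair_pre_digraph \<Rightarrow> bool" where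
  "agree_on P G H \<longleftrightarrow> (\<forall>p\<in>P. \<forall>u. (p, u) \<in> parcs G \<longleftrightarrow> (p, u) \<in> parcs H)"

lemma agree_on_residual_degree:
  assumes "pair_graph G" "pair_graph H" "agree_on P G H" "deg G y = deg H y"
  shows "card ({u. (y, u) \<in> parcs G} - P) = card ({u. (y, u) \<in> parcs H} - P)"
proof -
  have fin: "finite {u. (y, u) \<in> parcs G}" "finite {u. (y, u) \<in> parcs H}"
    using assms(1,2) by (auto simp: pair_graph_iff intro: finite_subset[of _ "pverts _"])
  have "(y, u) \<in> parcs G \<longleftrightarrow> (y, u) \<in> parcs H" if "u \<in> P" for u
    using that assms(1-3) unfolding pair_graph_iff agree_on_def by meson
  then have "{u. (y, u) \<in> parcs G} \<inter> P = {u. (y, u) \<in> parcs H} \<inter> P"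
    by blast
  then show ?thesis
    using assms(4) fin by (simp add: card_Diff_subset_Int deg_card)
qed

lemma switch_outside_agree_on:
  assumes "{a, b, c, d} \<inter> P = {}"
  shows "agree_on P (switch G a b c d) G"
  using assms by (auto simp: agree_on_def switch_def)

lemma agree_on_sym: "agree_on P G H \<Longrightarrow> agree_on P H G"
  and agree_on_trans: "agree_on P G H \<Longrightarrow> agree_on P H K \<Longrightarrow> agree_on P G K"
  by (simp_all add: agree_on_def)

text \<open>
  Let \<open>y\<close> be adjacent to \<open>v\<close> only in \<open>G\<close> and \<open>z\<close> only in \<open>H\<close>.  Outside \<open>P\<close> the degrees of \<open>y\<close> are
  the same in \<open>G\<close> and \<open>H\<close>, and so are those of \<open>z\<close>.  If \<open>y\<close> has the larger one, \<open>H\<close> admits a switch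
  that replaces \<open>vz\<close> by \<open>vy\<close>; otherwise \<open>G\<close> admits one that replaces \<open>vy\<close> by \<open>vz\<close>.  Either way
  the neighbourhoods of \<open>v\<close> become closer.
\<close>
lemma switches_to_agree_at_vertex:
  assumes "pair_graph G" "pair_graph H" "\<And>u. deg G u = deg H u" "agree_on P G H" "v \<notin> P"
  shows "\<exists>G' H'. (G, G') \<in> switch_rel\<^sup>* \<and> (H, H') \<in> switch_rel\<^sup>* \<and> agree_on (insert v P) G' H'"
  using assms
proof (induction "card ({u. (v, u) \<in> parcs G} - {u. (v, u) \<in> parcs H})" arbitrary: G H
    rule: less_induct)
  case less
  let ?NG = "{u. (v, u) \<in> parcs G}" and ?NH = "{u. (v, u) \<in> parcs H}"
  note G = less.prems(1) and H = less.prems(2) and degs = less.prems(3) and agree = less.prems(4)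
  have fin: "finite ?NG" "finite ?NH"
    using G H by (auto simp: pair_graph_iff intro: finite_subset[of _ "pverts _"])
  have cards: "card ?NG = card ?NH"
    using degs by (metis deg_card)
  show ?case
  proof (cases "?NG \<subseteq> ?NH")
    case True
    then have "?NG = ?NH"
      using cards fin by (simp add: card_subset_eq)
    then have "agree_on (insert v P) G H"
      using agree by (auto simp: agree_on_def)
    then show ?thesis
      by blast
  next
    case False
    then obtain y where y: "(v, y) \<in> parcs G" "(v, y) \<notin> parcs H"
      by blast
    have "\<not> ?NH \<subseteq> ?NG"
      using False cards fin by (metis card_subset_eq order_refl)
    then obtain z where z: "(v, z) \<in> parcs H" "(v, z) \<notin> parcs G"
      by blast
    have P: "y \<notin> P" "z \<notin> P"
      using y z agree G H unfolding agree_on_def pair_graph_iff by blast+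
    have neq: "y \<noteq> v" "z \<noteq> v" "y \<noteq> z"
      using y z G H by (auto simp: pair_graph_iff)
    have residual: "card ({u. (x, u) \<in> parcs G} - P) = card ({u. (x, u) \<in> parcs H} - P)" for x
      using agree_on_residual_degree[OF G H agree] degs by blast
    consider "card ({u. (z, u) \<in> parcs H} - P) \<le> card ({u. (y, u) \<in> parcs H} - P)"
      | "card ({u. (y, u) \<in> parcs G} - P) \<le> card ({u. (z, u) \<in> parcs G} - P)"
      using residual by (metis nat_le_linear)
    then show ?thesis
    proof cases
      case 1
      obtain u where u: "u \<notin> P" "switchable H v z u y"
        using exists_switch_to[OF H z(1) y(2) neq(1) less.prems(5) P 1] by blast
      let ?H' = "switch H v z u y"
      have "{w. (v, w) \<in> parcs ?H'} = insert y (?NH - {z})"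
        using switchable_distinct(1)[OF H u(2)] by (auto simp: switch_def)
      then have "?NG - {w. (v, w) \<in> parcs ?H'} = ?NG - ?NH - {y}"
        using z(2) by auto
      then have "card (?NG - {w. (v, w) \<in> parcs ?H'}) < card (?NG - ?NH)"
        using y fin(1) by (metis (no_types, lifting) DiffI card_Diff1_less finite_Diff mem_Collect_eq)
      moreover have "agree_on P G ?H'"
        using switch_outside_agree_on[of v z u y P H] u(1) P less.prems(5) agree
        by (auto intro: agree_on_trans agree_on_sym)
      moreover have "deg G x = deg ?H' x" for x
        using degs deg_switch[OF H u(2)] by simp
      ultimately obtain G' H' where "(G, G') \<in> switch_rel\<^sup>*" "(?H', H') \<in> switch_rel\<^sup>*"
          "agree_on (insert v P) G' H'"
        using less.hyps[of G ?H'] G pair_graph_switch[OF H u(2)] less.prems(5) by blast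
      then show ?thesis
        using switch_relI[OF H u(2)] by (meson converse_rtrancl_into_rtrancl)
    next
      case 2
      obtain u where u: "u \<notin> P" "switchable G v y u z"
        using exists_switch_to[OF G y(1) z(2) neq(2) less.prems(5) P(2,1) 2] by blast
      let ?G' = "switch G v y u z"
      have "{w. (v, w) \<in> parcs ?G'} = insert z (?NG - {y})"
        using switchable_distinct(1)[OF G u(2)] by (auto simp: switch_def)
      then have "{w. (v, w) \<in> parcs ?G'} - ?NH = ?NG - ?NH - {y}"
        using z(1) by auto
      then have "card ({w. (v, w) \<in> parcs ?G'} - ?NH) < card (?NG - ?NH)"
        using y fin(1) by (metis (no_types, lifting) DiffI card_Diff1_less finite_Diff mem_Collect_eq)
      moreover have "agree_on P ?G' H"
        using switch_outside_agree_on[of v y u z P G] u(1) P less.prems(5) agree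
        by (auto intro: agree_on_trans)
      moreover have "deg ?G' x = deg H x" for x
        using degs deg_switch[OF G u(2)] by simp
      ultimately obtain G' H' where "(?G', G') \<in> switch_rel\<^sup>*" "(H, H') \<in> switch_rel\<^sup>*"
          "agree_on (insert v P) G' H'"
        using less.hyps[of ?G' H] H pair_graph_switch[OF G u(2)] less.prems(5) by blast
      then show ?thesis
        using switch_relI[OF G u(2)] by (meson converse_rtrancl_into_rtrancl)
    qed
  qed
qed

text \<open>
  Making the two graphs agree at one vertex after the other leads both to a common graph.  Since a
  switch can be undone by a switch, the way from \<open>H\<close> to that graph can be walked back.
\<close>
theorem switch_connected:
  assumes "pair_graph G" "pair_graph H" "pverts G = pverts H" "\<And>u. deg G u = deg H u"
  shows "(G, H) \<in> switch_rel\<^sup>*"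
proof -
  have "finite (pverts G)"
    using assms(1) by (simp add: pair_graph_iff)
  then have "\<exists>G' H'. (G, G') \<in> switch_rel\<^sup>* \<and> (H, H') \<in> switch_rel\<^sup>* \<and> agree_on (pverts G) G' H'"
  proof (induction rule: finite_induct)
    case empty
    then show ?case
      by (auto simp: agree_on_def)
  next
    case (insert v P)
    then obtain G1 H1 where 1: "(G, G1) \<in> switch_rel\<^sup>*" "(H, H1) \<in> switch_rel\<^sup>*" "agree_on P G1 H1"
      by blast
    then have "pair_graph G1" "pair_graph H1" "\<And>u. deg G1 u = deg H1 u"
      using switch_rtrancl_invariants assms by metis+
    then obtain G2 H2 where "(G1, G2) \<in> switch_rel\<^sup>*" "(H1, H2) \<in> switch_rel\<^sup>*"
        "agree_on (insert v P) G2 H2"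
      using switches_to_agree_at_vertex[of G1 H1 P v] 1(3) insert.hyps(2) by blast
    then show ?case
      using 1(1,2) by (meson rtrancl_trans)
  qed
  then obtain G' H' where reach: "(G, G') \<in> switch_rel\<^sup>*" "(H, H') \<in> switch_rel\<^sup>*"
    and agree: "agree_on (pverts G) G' H'"
    by blast
  have "pair_graph G'" "pair_graph H'" "pverts G' = pverts G" "pverts H' = pverts G"
    using switch_rtrancl_invariants[OF reach(1)] switch_rtrancl_invariants[OF reach(2)] assms
    by simp_all
  then have "G' = H'"
    using agree by (auto simp: agree_on_def pair_graph_iff intro!: pair_pre_digraph.equality)
  moreover have "(H', H) \<in> switch_rel\<^sup>*"
    using reach(2) sym_rtrancl[OF sym_switch_rel] by (meson symD)
  ultimately show ?thesis
    using reach(1) by (meson rtrancl_trans)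
qed

section \<open>Forbidden graphs\<close>

definition forbidden_free :: "'a pair_pre_digraph \<Rightarrow> bool" where
  "forbidden_free G \<longleftrightarrow> \<not> (\<exists>F\<in>forbidden_graphs. contains_induced G F)"

lemma forbidden_free_degree_seq:
  assumes "pair_graph G" "forbidden_free G" "S \<subseteq> pverts G"
  shows "degree_seq (induce G S) \<notin> L1"
proof
  assume L1: "degree_seq (induce G S) \<in> L1"
  have pg: "pair_graph (induce G S)"
    using assms pair_graph_induce by blast
  obtain H :: "nat pair_pre_digraph" where H: "induce G S \<simeq> H"
    using isomorphic_nat_copy[OF pg] by blast
  then have "realization H (degree_seq (induce G S))"
    using pg isomorphic_pair_graph degree_seq_isomorphic by (auto simp: realization_def)
  then have "H \<in> forbidden_graphs"
    using L1 by (auto simp: forbidden_graphs_def)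
  moreover have "contains_induced G H"
    using assms(1,3) isomorphic_sym[OF H pg] contains_induced_iff by blast
  ultimately show False
    using assms(2) by (auto simp: forbidden_free_def)
qed

lemma contains_induced_list:
  assumes "pair_graph G" "pair_graph F" "pverts F = {0..<length xs}" "distinct xs" "set xs \<subseteq> pverts G"
    and adj: "\<forall>i\<in>set [0..<length xs]. \<forall>j\<in>set [0..<length xs].
               (xs ! i, xs ! j) \<in> parcs G \<longleftrightarrow> (i, j) \<in> parcs F"
  shows "contains_induced G F"
proof -
  have "F \<simeq> induce G (set xs)"
  proof (rule isomorphicI)
    show "bij_betw ((!) xs) (pverts F) (pverts (induce G (set xs)))"
      using assms(3,4) bij_betw_nth[of xs] by (simp add: atLeast0LessThan)
    show "(i, j) \<in> parcs F \<longleftrightarrow> (xs ! i, xs ! j) \<in> parcs (induce G (set xs))"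
      if "i \<in> pverts F" "j \<in> pverts F" for i j
      using that assms(3) adj by simp
  qed (use assms pair_graph_induce in auto)
  then show ?thesis
    using assms(1,5) contains_induced_iff by blast
qed

lemma pair_graph_K2_plus_C4: "pair_graph K2_plus_C4"
  by (auto simp: pair_graph_iff K2_plus_C4_def)

lemma pair_graph_complement:
  assumes "pair_graph G"
  shows "pair_graph (graph_complement G)"
  using assms by (auto simp: pair_graph_iff graph_complement_def)

lemma K2_plus_C4_forbidden:
  "K2_plus_C4 \<in> forbidden_graphs" "graph_complement K2_plus_C4 \<in> forbidden_graphs"
  using isomorphic_refl pair_graph_K2_plus_C4 pair_graph_complement
  by (auto simp: forbidden_graphs_def)

text \<open>
  The five vertices form a small explicit graph whose only unknowns are the adjacencies of \<open>v\<close> and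
  the pairs \<open>ac\<close> and \<open>bd\<close>.  Unless \<open>v\<close> treats \<open>b\<close> and \<open>d\<close> alike, and in the same way as they
  treat each other, its degree sequence is one of \<open>(2,2,2,1,1)\<close>, \<open>(3,2,2,2,1)\<close> and
  \<open>(3,3,2,2,2)\<close>.  The proof evaluates all cases.
\<close>
lemma splitting_vertex:
  assumes G: "pair_graph G" and sw: "switchable G a b c d"
    and v: "v \<notin> {a, b, c, d}"
    and split: "(v, a) \<in> parcs G \<longleftrightarrow> (v, c) \<notin> parcs G"
    and free: "degree_seq (induce G (set [a, b, c, d, v])) \<notin> L1"
  shows "(v, b) \<in> parcs G \<longleftrightarrow> (b, d) \<in> parcs G" "(v, d) \<in> parcs G \<longleftrightarrow> (b, d) \<in> parcs G"
proof -
  have sym: "(x, y) \<in> parcs G \<longleftrightarrow> (y, x) \<in> parcs G" and irr: "(x, x) \<notin> parcs G" for x y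
    using G by (auto simp: pair_graph_iff)
  have D: "distinct [a, b, c, d, v]"
    using switchable_distinct[OF G sw] v by auto
  have E: "(a, b) \<in> parcs G" "(b, a) \<in> parcs G" "(c, d) \<in> parcs G" "(d, c) \<in> parcs G"
    "(a, d) \<notin> parcs G" "(d, a) \<notin> parcs G" "(b, c) \<notin> parcs G" "(c, b) \<notin> parcs G"
    using sw sym by (auto simp: switchable_def)
  note flip = sym[of a v] sym[of b v] sym[of c v] sym[of d v] sym[of c a] sym[of d b]
  have "((v, b) \<in> parcs G \<longleftrightarrow> (b, d) \<in> parcs G) \<and> ((v, d) \<in> parcs G \<longleftrightarrow> (b, d) \<in> parcs G)"
    using free split unfolding degree_seq_induce_list[OF D]
    by (cases "(v, b) \<in> parcs G"; cases "(v, d) \<in> parcs G"; cases "(b, d) \<in> parcs G";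
        cases "(v, a) \<in> parcs G"; cases "(a, c) \<in> parcs G")
       (simp_all add: E irr flip L1_def eval_nat_numeral)
  then show "(v, b) \<in> parcs G \<longleftrightarrow> (b, d) \<in> parcs G" "(v, d) \<in> parcs G \<longleftrightarrow> (b, d) \<in> parcs G"
    by simp_all
qed

text \<open>
  By the preceding lemma, used once for \<open>v\<close> and once, with the roles of the pairs \<open>a, c\<close> and
  \<open>b, d\<close> exchanged, for \<open>w\<close>, the six vertices form a graph with only four unknowns: the pairs
  \<open>ac\<close>, \<open>bd\<close>, \<open>vw\<close>, and the choice between \<open>b\<close> and \<open>d\<close> as neighbour of \<open>w\<close>.  The degree sequence
  does not depend on that choice.  It belongs to \<^term>\<open>L1\<close> except in two cases, in which it is
  \<open>(2,2,2,2,1,1)\<close> or \<open>(4,4,3,3,3,3)\<close>.  In the first case the graph is \<open>K\<^sub>2 + C\<^sub>4\<close> or a path on six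
  vertices, depending on the choice, and in the second one it is the complement of one of these.
\<close>
lemma no_two_splitting_vertices:
  assumes G: "pair_graph G" and free: "forbidden_free G" and sw: "switchable G a b c d"
    and v: "v \<in> pverts G - {a, b, c, d}" "(v, a) \<in> parcs G" "(v, c) \<notin> parcs G"
    and w: "w \<in> pverts G - {a, b, c, d}" "(w, b) \<in> parcs G \<longleftrightarrow> (w, d) \<notin> parcs G"
  shows False
proof -
  have sym: "(x, y) \<in> parcs G \<longleftrightarrow> (y, x) \<in> parcs G" and irr: "(x, x) \<notin> parcs G" for x y
    using G by (auto simp: pair_graph_iff)
  note abcd = switchable_distinct[OF G sw]
  have E: "(a, b) \<in> parcs G" "(b, a) \<in> parcs G" "(c, d) \<in> parcs G" "(d, c) \<in> parcs G"
    "(a, d) \<notin> parcs G" "(d, a) \<notin> parcs G" "(b, c) \<notin> parcs G" "(c, b) \<notin> parcs G"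
    using sw sym by (auto simp: switchable_def)
  have V: "(v, b) \<in> parcs G \<longleftrightarrow> (b, d) \<in> parcs G" "(v, d) \<in> parcs G \<longleftrightarrow> (b, d) \<in> parcs G"
    using splitting_vertex[OF G sw, of v] v forbidden_free_degree_seq[OF G free, of "set [a, b, c, d, v]"] abcd(2)
    by auto
  have "switchable G b a d c"
    using sw sym by (auto simp: switchable_def)
  then have W: "(w, a) \<in> parcs G \<longleftrightarrow> (a, c) \<in> parcs G" "(w, c) \<in> parcs G \<longleftrightarrow> (a, c) \<in> parcs G"
    using splitting_vertex[OF G, of b a d c w] w forbidden_free_degree_seq[OF G free, of "set [b, a, d, c, w]"] abcd(2)
    by auto
  have "v \<noteq> w"
    using V w by auto
  then have D: "distinct [a, b, c, d, v, w]"
    using abcd(1) v(1) w(1) by auto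
  note flip = sym[of a v] sym[of b v] sym[of c v] sym[of d v] sym[of c a] sym[of d b]
    sym[of a w] sym[of b w] sym[of c w] sym[of d w] sym[of w v]
  note simps = E irr flip V W v(2,3)
  have 6: "degree_seq (induce G (set [a, b, c, d, v, w])) \<notin> L1"
    using abcd(2) v(1) w(1) by (intro forbidden_free_degree_seq[OF G free]) auto
  have "((a, c) \<in> parcs G \<longleftrightarrow> (b, d) \<in> parcs G) \<and> ((v, w) \<in> parcs G \<longleftrightarrow> (a, c) \<notin> parcs G)"
    using 6 w(2) unfolding degree_seq_induce_list[OF D]
    by (cases "(a, c) \<in> parcs G"; cases "(b, d) \<in> parcs G"; cases "(v, w) \<in> parcs G";
        cases "(w, b) \<in> parcs G")
       (simp_all add: simps L1_def eval_nat_numeral)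
  then consider
      "(a, c) \<notin> parcs G" "(b, d) \<notin> parcs G" "(v, w) \<in> parcs G" "(w, b) \<in> parcs G" "(w, d) \<notin> parcs G"
    | "(a, c) \<notin> parcs G" "(b, d) \<notin> parcs G" "(v, w) \<in> parcs G" "(w, b) \<notin> parcs G" "(w, d) \<in> parcs G"
    | "(a, c) \<in> parcs G" "(b, d) \<in> parcs G" "(v, w) \<notin> parcs G" "(w, b) \<in> parcs G" "(w, d) \<notin> parcs G"
    | "(a, c) \<in> parcs G" "(b, d) \<in> parcs G" "(v, w) \<notin> parcs G" "(w, b) \<notin> parcs G" "(w, d) \<in> parcs G"
    using w(2) by blast
  then show False
  proof cases
    case 1
    \<comment> \<open>The edge \<open>cd\<close> and the four-cycle \<open>a, b, w, v\<close>.\<close>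
    let ?xs = "[c, d, a, b, w, v]"
    have "contains_induced G K2_plus_C4"
    proof (rule contains_induced_list[OF G pair_graph_K2_plus_C4, of ?xs])
      show "pverts K2_plus_C4 = {0..<length ?xs}"
        by (simp add: K2_plus_C4_def eval_nat_numeral)
      show "distinct ?xs" "set ?xs \<subseteq> pverts G"
        using D abcd(2) v(1) w(1) by auto
      show "\<forall>i\<in>set [0..<length ?xs]. \<forall>j\<in>set [0..<length ?xs].
          (?xs ! i, ?xs ! j) \<in> parcs G \<longleftrightarrow> (i, j) \<in> parcs K2_plus_C4"
        using 1 by (simp add: simps upt_rec K2_plus_C4_def)
    qed
    then show False
      using free K2_plus_C4_forbidden by (auto simp: forbidden_free_def)
  next
    case 2
    \<comment> \<open>The path \<open>b, a, v, w, d, c\<close> without its end \<open>c\<close>.\<close>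
    have D': "distinct [b, a, v, w, d]"
      using D by auto
    have "degree_seq (induce G (set [b, a, v, w, d])) = [2, 2, 2, 1, 1]"
      unfolding degree_seq_induce_list[OF D'] using 2 by (simp add: simps eval_nat_numeral)
    then show False
      using forbidden_free_degree_seq[OF G free, of "set [b, a, v, w, d]"] abcd(2) v(1) w(1)
      by (auto simp: L1_def)
  next
    case 3
    \<comment> \<open>The non-edges form the path \<open>a, d, w, v, c, b\<close>; its end \<open>b\<close> is left out.\<close>
    have D': "distinct [a, c, d, v, w]"
      using D by auto
    have "degree_seq (induce G (set [a, c, d, v, w])) = [3, 3, 2, 2, 2]"
      unfolding degree_seq_induce_list[OF D'] using 3 by (simp add: simps eval_nat_numeral)
    then show False
      using forbidden_free_degree_seq[OF G free, of "set [a, c, d, v, w]"] abcd(2) v(1) w(1)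
      by (auto simp: L1_def)
  next
    case 4
    \<comment> \<open>The non-edges are \<open>ad\<close> and the four-cycle \<open>v, c, b, w\<close>.\<close>
    let ?xs = "[a, d, v, c, b, w]"
    have "contains_induced G (graph_complement K2_plus_C4)"
    proof (rule contains_induced_list[OF G pair_graph_complement[OF pair_graph_K2_plus_C4], of ?xs])
      show "pverts (graph_complement K2_plus_C4) = {0..<length ?xs}"
        by (simp add: K2_plus_C4_def graph_complement_def eval_nat_numeral)
      show "distinct ?xs" "set ?xs \<subseteq> pverts G"
        using D abcd(2) v(1) w(1) by auto
      show "\<forall>i\<in>set [0..<length ?xs]. \<forall>j\<in>set [0..<length ?xs].
          (?xs ! i, ?xs ! j) \<in> parcs G \<longleftrightarrow> (i, j) \<in> parcs (graph_complement K2_plus_C4)"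
        using 4 by (simp add: simps upt_rec K2_plus_C4_def graph_complement_def)
    qed
    then show False
      using free K2_plus_C4_forbidden by (auto simp: forbidden_free_def)
  qed
qed

text \<open>
  The labelling \<open>c, d, a, b\<close> describes the same switch as \<open>a, b, c, d\<close>, so the vertex that
  distinguishes \<open>a\<close> from \<open>c\<close> may be taken to be adjacent to \<open>a\<close>.
\<close>
lemma forbidden_free_twins:
  assumes G: "pair_graph G" and free: "forbidden_free G" and sw: "switchable G a b c d"
  shows "(\<forall>x\<in>pverts G - {a, b, c, d}. (x, a) \<in> parcs G \<longleftrightarrow> (x, c) \<in> parcs G) \<or>
         (\<forall>x\<in>pverts G - {a, b, c, d}. (x, b) \<in> parcs G \<longleftrightarrow> (x, d) \<in> parcs G)"
proof (rule ccontr)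
  assume "\<not> ?thesis"
  then obtain v w where
      v: "v \<in> pverts G - {a, b, c, d}" "(v, a) \<in> parcs G \<longleftrightarrow> (v, c) \<notin> parcs G"
    and w: "w \<in> pverts G - {a, b, c, d}" "(w, b) \<in> parcs G \<longleftrightarrow> (w, d) \<notin> parcs G"
    by blast
  show False
  proof (cases "(v, a) \<in> parcs G")
    case True
    then show False
      using no_two_splitting_vertices[OF G free sw v(1)] v(2) w by blast
  next
    case False
    have "switchable G c d a b"
      using sw G by (auto simp: switchable_def pair_graph_iff)
    moreover have "pverts G - {c, d, a, b} = pverts G - {a, b, c, d}"
      by blast
    ultimately show False
      using no_two_splitting_vertices[OF G free, of c d a b v w] v w False by simp
  qed
qed

text \<open>
  The transposition of \<open>a\<close> and \<open>c\<close> carries the edges \<open>ab\<close>, \<open>cd\<close> to \<open>cb\<close>, \<open>ad\<close>, fixes the pairs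
  \<open>ac\<close> and \<open>bd\<close>, and does not affect adjacency to vertices outside \<open>{a, b, c, d}\<close>.
\<close>
lemma switch_isomorphic_if_twins:
  assumes G: "pair_graph G" and sw: "switchable G a b c d"
    and twins: "\<forall>x\<in>pverts G - {a, b, c, d}. (x, a) \<in> parcs G \<longleftrightarrow> (x, c) \<in> parcs G"
  shows "G \<simeq> switch G a b c d"
proof (rule isomorphicI[OF G pair_graph_switch[OF G sw]])
  note abcd = switchable_distinct[OF G sw]
  have sym: "(x, y) \<in> parcs G \<longleftrightarrow> (y, x) \<in> parcs G" and irr: "(x, x) \<notin> parcs G" for x y
    using G by (auto simp: pair_graph_iff)
  show "bij_betw (transpose a c) (pverts G) (pverts (switch G a b c d))"
    using abcd(2) by (simp add: bij_betw_transpose_iff)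
  fix x y assume xy: "x \<in> pverts G" "y \<in> pverts G"
  have E: "(a, b) \<in> parcs G" "(b, a) \<in> parcs G" "(c, d) \<in> parcs G" "(d, c) \<in> parcs G"
    "(a, d) \<notin> parcs G" "(d, a) \<notin> parcs G" "(b, c) \<notin> parcs G" "(c, b) \<notin> parcs G"
    using sw sym by (auto simp: switchable_def)
  have tw: "(z, a) \<in> parcs G \<longleftrightarrow> (z, c) \<in> parcs G" "(a, z) \<in> parcs G \<longleftrightarrow> (c, z) \<in> parcs G"
    if "z \<in> pverts G" "z \<notin> {a, b, c, d}" for z
    using that twins sym[of z] by auto
  have neq: "a \<noteq> b" "a \<noteq> c" "a \<noteq> d" "b \<noteq> c" "b \<noteq> d" "c \<noteq> d"
    using abcd(1) by auto
  have cases: "z = a \<or> z = b \<or> z = c \<or> z = d \<or> z \<notin> {a, b, c, d}" for z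
    by blast
  show "(x, y) \<in> parcs G \<longleftrightarrow> (transpose a c x, transpose a c y) \<in> parcs (switch G a b c d)"
    using cases[of x] cases[of y]
    by (elim disjE)
       (use neq neq[symmetric] tw[OF xy(1)] tw[OF xy(2)] in
         \<open>simp_all add: E irr sym[of c a] switch_def transpose_def\<close>)
qed

lemma forbidden_free_switch_isomorphic:
  assumes G: "pair_graph G" and free: "forbidden_free G" and sw: "switchable G a b c d"
  shows "G \<simeq> switch G a b c d"
  using forbidden_free_twins[OF assms]
proof
  assume "\<forall>x\<in>pverts G - {a, b, c, d}. (x, a) \<in> parcs G \<longleftrightarrow> (x, c) \<in> parcs G"
  then show ?thesis
    by (rule switch_isomorphic_if_twins[OF G sw])
next
  assume "\<forall>x\<in>pverts G - {a, b, c, d}. (x, b) \<in> parcs G \<longleftrightarrow> (x, d) \<in> parcs G"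
  moreover have "switchable G b a d c"
    using sw G by (auto simp: switchable_def pair_graph_iff)
  moreover have "pverts G - {b, a, d, c} = pverts G - {a, b, c, d}"
    by blast
  moreover have "switch G b a d c = switch G a b c d"
    by (auto simp: switch_def)
  ultimately show ?thesis
    using switch_isomorphic_if_twins[OF G, of b a d c] by simp
qed

section \<open>Forbidden-free graphs are unigraphs\<close>

lemma contains_induced_isomorphic:
  assumes "G \<simeq> H" "pair_graph G" "contains_induced G F"
  shows "contains_induced H F"
proof -
  obtain S where "S \<subseteq> pverts G" "F \<simeq> induce G S"
    using assms contains_induced_iff by blast
  moreover from this obtain T where "T \<subseteq> pverts H" "induce G S \<simeq> induce H T"
    using isomorphic_induce assms(1,2) by blast
  ultimately show ?thesis
    using isomorphic_pair_graph[OF assms(1,2)] contains_induced_iff digraph_iso_trans by blast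
qed

lemma forbidden_free_isomorphic:
  assumes "G \<simeq> H" "pair_graph G" "forbidden_free G"
  shows "forbidden_free H"
  using contains_induced_isomorphic isomorphic_sym isomorphic_pair_graph assms
  unfolding forbidden_free_def by metis

lemma forbidden_free_induce:
  assumes "pair_graph G" "S \<subseteq> pverts G" "forbidden_free G"
  shows "forbidden_free (induce G S)"
proof -
  have "contains_induced G F" if F: "contains_induced (induce G S) F" for F :: "nat pair_pre_digraph"
  proof -
    obtain T where "T \<subseteq> S" "F \<simeq> induce (induce G S) T"
      using F contains_induced_iff[OF pair_graph_induce[OF assms(1,2)]] by auto
    then show ?thesis
      using contains_induced_iff[OF assms(1)] assms(2) induce_induce[of T S G]
      by (metis order_trans)
  qed
  then show ?thesis
    using assms(3) by (auto simp: forbidden_free_def)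
qed

text \<open>
  Along a chain of switches each graph is isomorphic to \<open>G\<close>, hence again forbidden-free, so the
  next switch preserves the isomorphism class as well.
\<close>
lemma forbidden_free_switches_isomorphic:
  assumes "(G, H) \<in> switch_rel\<^sup>*" "pair_graph G" "forbidden_free G"
  shows "G \<simeq> H"
  using assms(1)
proof (induction rule: rtrancl_induct)
  case base
  then show ?case
    using isomorphic_refl assms(2) by blast
next
  case (step K H)
  then obtain a b c d where K: "H = switch K a b c d" "switchable K a b c d" "pair_graph K"
    unfolding switch_rel_def by blast
  have "K \<simeq> H"
    using forbidden_free_switch_isomorphic[OF K(3) _ K(2)] K(1)
      forbidden_free_isomorphic[OF step.IH assms(2,3)] by blast
  then show ?case
    using step.IH digraph_iso_trans by blast
qed

lemma forbidden_free_isomorphic_if_degree_seq_eq: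
  assumes G: "pair_graph (G :: 'a pair_pre_digraph)" "forbidden_free G"
    and H: "pair_graph (H :: 'b pair_pre_digraph)" "degree_seq H = degree_seq G"
  shows "G \<simeq> H"
proof -
  have fin: "finite (pverts G)" "finite (pverts H)"
    using G(1) H(1) by (simp_all add: pair_graph_iff)
  obtain h where h: "bij_betw h (pverts H) (pverts G)" "\<And>x. x \<in> pverts H \<Longrightarrow> deg G (h x) = deg H x"
    using bij_betw_of_image_mset_eq[OF fin(2,1) H(2)[unfolded degree_seq_eq_iff]] by blast
  let ?H = "map_graph h H"
  have inj: "inj_on h (pverts H)"
    using h(1) by (simp add: bij_betw_def)
  have V: "pverts ?H = pverts G"
    using h(1) by (simp add: bij_betw_def map_graph_def)
  note H' = pair_graph_map_graph[OF H(1) inj]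
  have "deg G u = deg ?H u" for u
  proof (cases "u \<in> pverts G")
    case True
    then obtain x where x: "x \<in> pverts H" "u = h x"
      using h(1) by (metis bij_betw_imp_surj_on imageE)
    have "deg ?H (h x) = deg H x"
      using isomorphic_deg[OF H(1) H', of h] map_graph_adjacent_iff[OF H(1) inj] h(1) V x(1) by simp
    then show ?thesis
      using h(2) x by simp
  next
    case False
    then have "{v. (u, v) \<in> parcs G} = {}" "{v. (u, v) \<in> parcs ?H} = {}"
      using G(1) H' V by (auto simp: pair_graph_iff)
    then show ?thesis
      by (simp add: deg_card)
  qed
  then have "G \<simeq> ?H"
    using forbidden_free_switches_isomorphic switch_connected G H' V by metis
  then show ?thesis
    using isomorphic_sym[OF isomorphic_map_graph[OF H(1) inj] H(1)] digraph_iso_trans by blast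
qed

lemma forbidden_free_hereditary_unigraph:
  assumes "pair_graph G" "forbidden_free G"
  shows "hereditary_unigraph G"
proof -
  have unigraph: "unigraph K" if "pair_graph K" "forbidden_free K" for K :: "'a pair_pre_digraph"
    using that forbidden_free_isomorphic_if_degree_seq_eq
    by (auto simp: unigraph_def realization_def)
  moreover have "unigraph K" if "induced_subgraph (with_proj K) (with_proj G)" for K
  proof -
    have "pverts K \<subseteq> pverts G" "K = induce G (pverts K)"
      using that induced_subgraph_iff[OF assms(1)] by blast+
    then show ?thesis
      using unigraph[of K] pair_graph_induce[OF assms(1)] forbidden_free_induce[OF assms(1) _ assms(2)]
      by metis
  qed
  ultimately show ?thesis
    using assms by (auto simp: hereditary_unigraph_def)
qed

section \<open>Forbidden graphs are not unigraphs\<close>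

definition edge_graph :: "nat \<Rightarrow> (nat \<times> nat) list \<Rightarrow> nat pair_pre_digraph" where
  "edge_graph n es = \<lparr>pverts = {0..<n}, parcs = set es \<union> (set es)\<inverse>\<rparr>"

lemma pair_graph_edge_graph:
  assumes "\<forall>(u, v)\<in>set es. u < n \<and> v < n \<and> u \<noteq> v"
  shows "pair_graph (edge_graph n es)"
  using assms by (auto simp: pair_graph_iff edge_graph_def)

text \<open>
  Whether vertices of degrees \<open>p\<close> and \<open>q\<close> are joined by an edge is an isomorphism invariant.  It is
  strong enough to separate all the pairs of graphs needed below.
\<close>
definition joined :: "nat \<Rightarrow> nat \<Rightarrow> 'a pair_pre_digraph \<Rightarrow> bool" where
  "joined p q G \<longleftrightarrow> (\<exists>(u, v)\<in>parcs G. deg G u = p \<and> deg G v = q)"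

lemma joined_isomorphic:
  assumes "G \<simeq> H" "pair_graph G" "joined p q G"
  shows "joined p q H"
proof -
  obtain f where f: "bij_betw f (pverts G) (pverts H)"
    "\<And>u v. u \<in> pverts G \<Longrightarrow> v \<in> pverts G \<Longrightarrow> (u, v) \<in> parcs G \<longleftrightarrow> (f u, f v) \<in> parcs H"
    "parcs H \<subseteq> pverts H \<times> pverts H"
    using isomorphicE[OF assms(1,2)] by blast
  obtain u v where "(u, v) \<in> parcs G" "deg G u = p" "deg G v = q"
    using assms(3) by (auto simp: joined_def)
  moreover from this have "u \<in> pverts G" "v \<in> pverts G"
    using assms(2) by (auto simp: pair_graph_iff)
  ultimately show ?thesis
    using f(2)[of u v] isomorphic_deg[OF assms(2) isomorphic_pair_graph[OF assms(1,2)] f(1,2)]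
    by (auto simp: joined_def intro!: bexI[of _ "(f u, f v)"])
qed

lemma edge_graph_degree_seq:
  assumes "\<forall>(u, v)\<in>set es. u < n \<and> v < n \<and> u \<noteq> v"
  shows "degree_seq (edge_graph n es) =
    rev (sort (map (\<lambda>v. length (filter (\<lambda>u. (v, u) \<in> set es \<or> (u, v) \<in> set es) [0..<n])) [0..<n]))"
proof -
  have "parcs (edge_graph n es) \<subseteq> pverts (edge_graph n es) \<times> pverts (edge_graph n es)"
    using pair_graph_edge_graph[OF assms] by (simp add: pair_graph_iff)
  then show ?thesis
    using degree_seq_list[of "[0..<n]" "edge_graph n es"] by (simp add: edge_graph_def)
qed

lemma edge_graph_joined:
  assumes "\<forall>(u, v)\<in>set es. u < n \<and> v < n \<and> u \<noteq> v"
  shows "joined p q (edge_graph n es) \<longleftrightarrow>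
    (let d = \<lambda>v. length (filter (\<lambda>u. (v, u) \<in> set es \<or> (u, v) \<in> set es) [0..<n]);
         ds = map (\<lambda>(u, v). (d u, d v)) es
     in (p, q) \<in> set ds \<or> (q, p) \<in> set ds)"
proof -
  have "deg (edge_graph n es) v = length (filter (\<lambda>u. (v, u) \<in> set es \<or> (u, v) \<in> set es) [0..<n])" for v
  proof -
    have "{u. (v, u) \<in> parcs (edge_graph n es)} \<subseteq> set [0..<n]"
      using assms by (auto simp: edge_graph_def)
    then show ?thesis
      using deg_list[of "[0..<n]" v "edge_graph n es"] by (simp add: edge_graph_def)
  qed
  then show ?thesis
    unfolding joined_def Let_def by (auto simp: edge_graph_def image_iff split_beta Bex_def)
qed

text \<open>
  The two realizations come from the configurations of \<open>no_two_splitting_vertices\<close>, with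
  \<open>0, 1, 2, 3\<close> as \<open>a, b, c, d\<close>, with \<open>4\<close> as \<open>v\<close>, and with \<open>5\<close>, or again \<open>4\<close> in the graphs on five
  vertices, as \<open>w\<close>.  The vertices \<open>1\<close> and \<open>3\<close> have equal degrees before the last edge is added at
  \<open>w\<close>, so that edge can go to either of them without changing the degree sequence.
\<close>
lemma two_realizations:
  assumes "\<rho> \<in> L1 \<union> {[2,2,2,2,1,1], [4,4,3,3,3,3]}"
  shows "\<exists>(R1 :: nat pair_pre_digraph) (R2 :: nat pair_pre_digraph).
    realization R1 \<rho> \<and> realization R2 \<rho> \<and> \<not> R1 \<simeq> R2"
proof -
  have *: ?thesis
    if "\<forall>(u, v)\<in>set (es1 @ es2 @ es). u < n \<and> v < n \<and> u \<noteq> v"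
      "degree_seq (edge_graph n (es1 @ es)) = \<rho>" "degree_seq (edge_graph n (es2 @ es)) = \<rho>"
      "joined p q (edge_graph n (es1 @ es))" "\<not> joined p q (edge_graph n (es2 @ es))"
    for n es1 es2 es p q
  proof -
    have "pair_graph (edge_graph n (es1 @ es))" "pair_graph (edge_graph n (es2 @ es))"
      using that(1) by (auto intro!: pair_graph_edge_graph)
    moreover from this have "\<not> edge_graph n (es1 @ es) \<simeq> edge_graph n (es2 @ es)"
      using joined_isomorphic[OF _ _ that(4)] that(5) by blast
    ultimately show ?thesis
      using that(2,3) unfolding realization_def by blast
  qed
  note eval = edge_graph_degree_seq edge_graph_joined Let_def upt_rec eval_nat_numeral
  \<comment> \<open>The last two numbers in each case are degrees that are joined by an edge in the first
    realization only.\<close>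
  let ?es = "[(0, 1), (2, 3), (4, 0)] :: (nat \<times> nat) list"
  consider "\<rho> = [2,2,2,1,1]" | "\<rho> = [3,2,2,2,1]" | "\<rho> = [3,3,2,2,2]" | "\<rho> = [2,2,1,1,1,1]"
    | "\<rho> = [4,3,3,2,1,1]" | "\<rho> = [4,4,3,2,2,1]" | "\<rho> = [4,4,4,4,3,3]"
    | "\<rho> = [2,2,2,2,1,1]" | "\<rho> = [4,4,3,3,3,3]"
    using assms unfolding L1_def Un_iff insert_iff empty_iff by argo
  then show ?thesis
  proof cases
    case 1
    then show ?thesis
      by (intro *[of "[(4, 1)]" "[(4, 3)]" ?es 5 1 1]) (simp_all add: eval)
  next
    case 2
    then show ?thesis
      by (intro *[of "[(4, 1)]" "[(4, 3)]" "[(0, 2)] @ ?es" 5 1 2]) (simp_all add: eval)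
  next
    case 3
    then show ?thesis
      by (intro *[of "[(4, 1)]" "[(4, 3)]" "[(0, 2), (1, 3)] @ ?es" 5 3 3]) (simp_all add: eval)
  next
    case 4
    then show ?thesis
      by (intro *[of "[(5, 1)]" "[(5, 3)]" ?es 6 1 1]) (simp_all add: eval)
  next
    case 5
    then show ?thesis
      by (intro *[of "[(5, 1)]" "[(5, 3)]" "[(0, 2), (5, 0), (5, 2)] @ ?es" 6 1 3]) (simp_all add: eval)
  next
    case 6
    then show ?thesis
      by (intro *[of "[(5, 1)]" "[(5, 3)]" "[(4, 5), (0, 2), (5, 0), (5, 2)] @ ?es" 6 1 3])
         (simp_all add: eval)
  next
    case 7
    then show ?thesis
      by (intro *[of "[(5, 1)]" "[(5, 3)]"
            "[(4, 5), (0, 2), (5, 0), (5, 2), (1, 3), (4, 1), (4, 3)] @ ?es" 6 3 3])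
         (simp_all add: eval)
  next
    case 8
    then show ?thesis
      by (intro *[of "[(5, 1)]" "[(5, 3)]" "[(4, 5)] @ ?es" 6 1 1]) (simp_all add: eval)
  next
    case 9
    then show ?thesis
      by (intro *[of "[(5, 1)]" "[(5, 3)]"
            "[(0, 2), (5, 0), (5, 2), (1, 3), (4, 1), (4, 3)] @ ?es" 6 4 4])
         (simp_all add: eval)
  qed
qed

lemma degree_seq_K2_plus_C4:
  "degree_seq K2_plus_C4 = [2,2,2,2,1,1]"
  "degree_seq (graph_complement K2_plus_C4) = [4,4,3,3,3,3]"
proof -
  have sub: "parcs K2_plus_C4 \<subseteq> pverts K2_plus_C4 \<times> pverts K2_plus_C4"
    "parcs (graph_complement K2_plus_C4) \<subseteq> pverts (graph_complement K2_plus_C4) \<times> pverts (graph_complement K2_plus_C4)"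
    using pair_graph_K2_plus_C4 pair_graph_complement[OF pair_graph_K2_plus_C4]
    by (simp_all add: pair_graph_iff)
  have V: "pverts K2_plus_C4 = set [0..<6]" "pverts (graph_complement K2_plus_C4) = set [0..<6]"
    by (simp_all add: K2_plus_C4_def graph_complement_def)
  show "degree_seq K2_plus_C4 = [2,2,2,2,1,1]"
    unfolding degree_seq_list[OF distinct_upt V(1) sub(1)]
    by (simp add: K2_plus_C4_def upt_rec eval_nat_numeral)
  show "degree_seq (graph_complement K2_plus_C4) = [4,4,3,3,3,3]"
    unfolding degree_seq_list[OF distinct_upt V(2) sub(2)]
    by (simp add: K2_plus_C4_def graph_complement_def upt_rec eval_nat_numeral)
qed

lemma contains_forbidden_imp_not_hereditary_unigraph:
  assumes G: "pair_graph G" and F: "F \<in> forbidden_graphs" "contains_induced G F"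
  shows "\<not> hereditary_unigraph G"
proof
  assume her: "hereditary_unigraph G"
  obtain H where H: "induced_subgraph (with_proj H) (with_proj G)" "F \<simeq> H"
    using F(2) by (auto simp: contains_induced_def)
  then have uni: "unigraph H"
    using her by (auto simp: hereditary_unigraph_def)
  have "pair_graph F \<and> degree_seq F \<in> L1 \<union> {[2,2,2,2,1,1], [4,4,3,3,3,3]}"
    using F(1) pair_graph_K2_plus_C4 pair_graph_complement[OF pair_graph_K2_plus_C4]
    by (auto simp: forbidden_graphs_def realization_def degree_seq_isomorphic degree_seq_K2_plus_C4
        intro: isomorphic_pair_graph)
  then have "degree_seq H \<in> L1 \<union> {[2,2,2,2,1,1], [4,4,3,3,3,3]}"
    using degree_seq_isomorphic H(2) by metis
  then obtain R1 R2 :: "nat pair_pre_digraph" where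
      R: "realization R1 (degree_seq H)" "realization R2 (degree_seq H)" "\<not> R1 \<simeq> R2"
    using two_realizations by blast
  then have "H \<simeq> R1" "H \<simeq> R2" "pair_graph H"
    using uni by (auto simp: unigraph_def)
  then show False
    using R(3) isomorphic_sym digraph_iso_trans by blast
qed

section \<open>Rao containment\<close>

lemma rao_contained_induce:
  assumes "pair_graph (G :: 'a pair_pre_digraph)" "S \<subseteq> pverts G"
  shows "degree_seq (induce G S) \<preceq> degree_seq G"
proof -
  obtain H :: "nat pair_pre_digraph" where H: "G \<simeq> H"
    using isomorphic_nat_copy[OF assms(1)] .
  then obtain T where T: "T \<subseteq> pverts H" "induce G S \<simeq> induce H T"
    using isomorphic_induce assms by blast
  have pg: "pair_graph H" "pair_graph (induce H T)"
    using isomorphic_pair_graph[OF H assms(1)] pair_graph_induce T(1) by blast+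
  then have "realization H (degree_seq G)" "realization (induce H T) (degree_seq (induce G S))"
    using degree_seq_isomorphic[OF H assms(1)]
      degree_seq_isomorphic[OF T(2) pair_graph_induce[OF assms]]
    by (simp_all add: realization_def)
  moreover have "induced_subgraph (with_proj (induce H T)) (with_proj H)"
    using induced_subgraph_iff[OF pg(1), of "induce H T"] T(1) by simp
  ultimately show ?thesis
    unfolding rao_contained_def by blast
qed

text \<open>
  If \<open>x 0\<close>, \<open>x 1\<close> is the edge and \<open>x 2\<close>, \<open>x 3\<close>, \<open>x 4\<close>, \<open>x 5\<close> the four-cycle, then replacing
  the edges \<open>x 0 x 1\<close> and \<open>x 2 x 3\<close> by \<open>x 0 x 3\<close> and \<open>x 1 x 2\<close> produces the path
  \<open>x 0, x 3, x 4, x 5, x 2, x 1\<close>.  Omitting \<open>x 1\<close> leaves an induced path on five vertices.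
\<close>
lemma rao_contained_K2_plus_C4:
  assumes G: "pair_graph G" "contains_induced G K2_plus_C4"
  shows "[2,2,2,1,1] \<preceq> degree_seq G"
proof -
  obtain S where S: "S \<subseteq> pverts G" "K2_plus_C4 \<simeq> induce G S"
    using G contains_induced_iff by blast
  obtain x where x: "bij_betw x (pverts K2_plus_C4) (pverts (induce G S))"
    "\<And>i j. i \<in> pverts K2_plus_C4 \<Longrightarrow> j \<in> pverts K2_plus_C4 \<Longrightarrow>
       (i, j) \<in> parcs K2_plus_C4 \<longleftrightarrow> (x i, x j) \<in> parcs (induce G S)"
    "parcs (induce G S) \<subseteq> pverts (induce G S) \<times> pverts (induce G S)"
    using isomorphicE[OF S(2) pair_graph_K2_plus_C4] by blast
  have mem: "x i \<in> S" if "i < 6" for i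
    using x(1) that by (auto simp: bij_betw_def K2_plus_C4_def)
  have eq: "x i = x j \<longleftrightarrow> i = j" if "i < 6" "j < 6" for i j
    using x(1) that by (auto simp: bij_betw_def K2_plus_C4_def dest: inj_onD)
  have adj: "(x i, x j) \<in> parcs G \<longleftrightarrow> (i, j) \<in> parcs K2_plus_C4" if "i < 6" "j < 6" for i j
    using x(2)[of i j] that mem by (simp add: K2_plus_C4_def)
  have sw: "switchable G (x 0) (x 1) (x 2) (x 3)"
    by (simp add: switchable_def adj eq) (simp add: K2_plus_C4_def)
  let ?G = "switch G (x 0) (x 1) (x 2) (x 3)" and ?xs = "[x 0, x 3, x 4, x 5, x 2]"
  have "distinct ?xs"
    by (simp add: eq)
  then have "degree_seq (induce ?G (set ?xs)) = [2,2,2,1,1]"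
    by (simp add: degree_seq_induce_list switch_def eq adj K2_plus_C4_def eval_nat_numeral
        del: list.set)
  moreover have "set ?xs \<subseteq> pverts ?G"
    using mem S(1) by auto
  ultimately show ?thesis
    using rao_contained_induce[OF pair_graph_switch[OF G(1) sw]] degree_seq_switch[OF G(1) sw] by metis
qed

text \<open>
  This is the preceding argument in the complement: the same four vertices are switched, and the
  path now consists of non-edges.
\<close>
lemma rao_contained_complement_K2_plus_C4:
  assumes G: "pair_graph G" "contains_induced G (graph_complement K2_plus_C4)"
  shows "[3,3,2,2,2] \<preceq> degree_seq G"
proof -
  let ?K = "graph_complement K2_plus_C4"
  obtain S where S: "S \<subseteq> pverts G" "?K \<simeq> induce G S"
    using G contains_induced_iff by blast
  obtain x where x: "bij_betw x (pverts ?K) (pverts (induce G S))"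
    "\<And>i j. i \<in> pverts ?K \<Longrightarrow> j \<in> pverts ?K \<Longrightarrow>
       (i, j) \<in> parcs ?K \<longleftrightarrow> (x i, x j) \<in> parcs (induce G S)"
    "parcs (induce G S) \<subseteq> pverts (induce G S) \<times> pverts (induce G S)"
    using isomorphicE[OF S(2) pair_graph_complement[OF pair_graph_K2_plus_C4]] by blast
  have mem: "x i \<in> S" if "i < 6" for i
    using x(1) that by (auto simp: bij_betw_def K2_plus_C4_def graph_complement_def)
  have eq: "x i = x j \<longleftrightarrow> i = j" if "i < 6" "j < 6" for i j
    using x(1) that by (auto simp: bij_betw_def K2_plus_C4_def graph_complement_def dest: inj_onD)
  have adj: "(x i, x j) \<in> parcs G \<longleftrightarrow> (i, j) \<in> parcs ?K" if "i < 6" "j < 6" for i j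
    using x(2)[of i j] that mem by (simp add: K2_plus_C4_def graph_complement_def)
  have sw: "switchable G (x 0) (x 3) (x 2) (x 1)"
    by (simp add: switchable_def adj eq) (simp add: K2_plus_C4_def graph_complement_def)
  let ?G = "switch G (x 0) (x 3) (x 2) (x 1)" and ?xs = "[x 0, x 3, x 4, x 5, x 2]"
  have "distinct ?xs"
    by (simp add: eq)
  then have "degree_seq (induce ?G (set ?xs)) = [3,3,2,2,2]"
    by (simp add: degree_seq_induce_list switch_def eq adj K2_plus_C4_def graph_complement_def eval_nat_numeral
        del: list.set)
  moreover have "set ?xs \<subseteq> pverts ?G"
    using mem S(1) by auto
  ultimately show ?thesis
    using rao_contained_induce[OF pair_graph_switch[OF G(1) sw]] degree_seq_switch[OF G(1) sw] by metis
qed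

lemma contains_forbidden_imp_rao_contained:
  assumes G: "pair_graph G" and F: "F \<in> forbidden_graphs" "contains_induced G F"
  shows "\<exists>\<rho>\<in>L1. \<rho> \<preceq> degree_seq G"
proof -
  obtain S where S: "S \<subseteq> pverts G" "F \<simeq> induce G S"
    using F(2) G contains_induced_iff by blast
  consider "K2_plus_C4 \<simeq> F" | "graph_complement K2_plus_C4 \<simeq> F" | \<rho> where "\<rho> \<in> L1" "realization F \<rho>"
    using F(1) by (auto simp: forbidden_graphs_def)
  then show ?thesis
  proof cases
    case 1
    then have "contains_induced G K2_plus_C4"
      using S G contains_induced_iff digraph_iso_trans by blast
    then show ?thesis
      using rao_contained_K2_plus_C4[OF G] by (auto simp: L1_def)
  next
    case 2
    then have "contains_induced G (graph_complement K2_plus_C4)"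
      using S G contains_induced_iff digraph_iso_trans by blast
    then show ?thesis
      using rao_contained_complement_K2_plus_C4[OF G] by (auto simp: L1_def)
  next
    case 3
    then have "degree_seq (induce G S) = \<rho>"
      using degree_seq_isomorphic[OF S(2)] by (simp add: realization_def)
    then show ?thesis
      using rao_contained_induce[OF G S(1)] 3(1) by blast
  qed
qed

lemma forbidden_free_not_rao_contained:
  assumes G: "pair_graph G" "forbidden_free G" and "\<rho> \<in> L1"
  shows "\<not> \<rho> \<preceq> degree_seq G"
proof
  assume "\<rho> \<preceq> degree_seq G"
  then obtain K H :: "nat pair_pre_digraph" where
      K: "realization K \<rho>" and H: "realization H (degree_seq G)"
      and KH: "induced_subgraph (with_proj K) (with_proj H)"
    by (auto simp: rao_contained_def)
  then have pg: "pair_graph H"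
    by (simp add: realization_def)
  have "G \<simeq> H"
    using forbidden_free_isomorphic_if_degree_seq_eq[OF G pg] H by (simp add: realization_def)
  then have "forbidden_free H"
    using forbidden_free_isomorphic G by blast
  moreover have "pverts K \<subseteq> pverts H" "K = induce H (pverts K)"
    using KH induced_subgraph_iff[OF pg] by blast+
  ultimately have "degree_seq K \<notin> L1"
    using forbidden_free_degree_seq[OF pg] by metis
  then show False
    using K assms(3) by (simp add: realization_def)
qed

theorem theorem5p4:
  fixes G :: "'a pair_pre_digraph" and \<pi> :: "nat list"
  assumes "pair_graph G" and "degree_seq G = \<pi>"
  shows "(hereditary_unigraph G \<longleftrightarrow> \<not> (\<exists>F\<in>forbidden_graphs. contains_induced G F)) \<and>
         ((\<not> (\<exists>F\<in>forbidden_graphs. contains_induced G F)) \<longleftrightarrow> \<not> (\<exists>\<rho>\<in>L1. \<rho> \<preceq> \<pi>))"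
  using forbidden_free_hereditary_unigraph[OF assms(1)] contains_forbidden_imp_not_hereditary_unigraph[OF assms(1)]
    forbidden_free_not_rao_contained[OF assms(1)] contains_forbidden_imp_rao_contained[OF assms(1)]
    assms(2)
  unfolding forbidden_free_def by blast

end
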